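(* Let $\Omega\subset\mathbb C^n$ be a pseudoconvex domain and $\mathcal E:[0,1]\to\mathbb E_0$ a geodesic. If $\mathcal E(0)\subset\Omega$ and $\mathcal E(1)\subset\Omega$, then $\mathcal E(t)\subset\Omega$ for all $0\le t\le 1$.
   Context: A domain is a connected open set. An open set $\Omega\subset\mathbb C^n$ is pseudoconvex if it admits a continuous plurisubharmonic exhaustion function $u:\Omega\to\mathbb R$, i.e. one for which $\{\zeta\in\Omega:u(\zeta)\le c\}$ is compact for every $c\in\mathbb R$. A hermitian ellipsoid is the image of the open unit ball of $\mathbb C^n$ under an invertible $\mathbb C$-linear transformation (so it is centered at $0$); $\mathbb E_0$ denotes the set of all hermitian ellipsoids in $\mathbb C^n$. It is in bijection with the positive definite hermitian forms $h$ on $\mathbb C^n$, the ellipsoid corresponding to $h$ being $E_h=\{z\in\mathbb C^n:h(z,z)<1\}$. Geodesics in $\mathbb E_0$: given $E_h,E_k\in\mathbb E_0$, there is a unique positive (definite) self adjoint operator $A$ on the hermitian inner product space $(\mathbb C^n,h)$ such that $AE_h=E_k$; the geodesic $\mathcal E:[0,1]\to\mathbb E_0$ between $E_h$ and $E_k$ is $\mathcal E(t)=A^tE_h$, $0\le t\le1$, where $A^t=\exp(t\log A)$. Equivalently, $\mathcal E(t)=E_{h_t}$ with $h_t(z,w)=h(A^{-t}z,A^{-t}w)$. *)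

theory Defs
  imports "HOL-Analysis.Analysis"
begin

section \<open>Plurisubharmonic functions and pseudoconvexity\<close>

text \<open>
  Only continuous, real valued (pluri)subharmonic functions occur in the definition of
  pseudoconvexity, so continuity takes the place of upper semicontinuity and the value minus
  infinity is not needed. Subharmonicity is the sub-mean value property on all closed discs
  contained in the (open) domain.
\<close>

definition cont_subharmonic_on :: "complex set \<Rightarrow> (complex \<Rightarrow> real) \<Rightarrow> bool" where
  "cont_subharmonic_on D f \<longleftrightarrow> continuous_on D f \<and>
     (\<forall>a r. 0 < r \<longrightarrow> cball a r \<subseteq> D \<longrightarrow>
        f a \<le> 1 / (2 * pi) * integral {0..2 * pi} (\<lambda>\<theta>. f (a + of_real r * cis \<theta>)))"

definition cont_plurisubharmonic_on :: "(complex ^ 'n) set \<Rightarrow> (complex ^ 'n \<Rightarrow> real) \<Rightarrow> bool" where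
  "cont_plurisubharmonic_on \<Omega> u \<longleftrightarrow> continuous_on \<Omega> u \<and>
     (\<forall>z w. cont_subharmonic_on {\<zeta>. z + \<zeta> *s w \<in> \<Omega>} (\<lambda>\<zeta>. u (z + \<zeta> *s w)))"

definition pseudoconvex :: "(complex ^ 'n) set \<Rightarrow> bool" where
  "pseudoconvex \<Omega> \<longleftrightarrow> open \<Omega> \<and>
     (\<exists>u. cont_plurisubharmonic_on \<Omega> u \<and> (\<forall>c. compact {z \<in> \<Omega>. u z \<le> c}))"


section \<open>Hermitian ellipsoids\<close>

definition hermitian_ellipsoids :: "(complex ^ 'n) set set" where
  "hermitian_ellipsoids = {(\<lambda>z. M *v z) ` ball 0 1 | M :: complex ^ 'n ^ 'n. invertible M}"

definition pos_def_hermitian_form :: "(complex ^ 'n \<Rightarrow> complex ^ 'n \<Rightarrow> complex) \<Rightarrow> bool" where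
  "pos_def_hermitian_form h \<longleftrightarrow>
     (\<forall>z z' w. h (z + z') w = h z w + h z' w) \<and>
     (\<forall>c z w. h (c *s z) w = c * h z w) \<and>
     (\<forall>z w. h w z = cnj (h z w)) \<and>
     (\<forall>z. z \<noteq> 0 \<longrightarrow> 0 < Re (h z z))"

definition ellipsoid_of :: "(complex ^ 'n \<Rightarrow> complex ^ 'n \<Rightarrow> complex) \<Rightarrow> (complex ^ 'n) set" where
  "ellipsoid_of h = {z. Re (h z z) < 1}"


section \<open>Geodesics\<close>

text \<open>Linear operators are represented by their matrices in the standard basis.\<close>

definition self_adjoint_wrt ::
    "(complex ^ 'n \<Rightarrow> complex ^ 'n \<Rightarrow> complex) \<Rightarrow> complex ^ 'n ^ 'n \<Rightarrow> bool" where
  "self_adjoint_wrt h A \<longleftrightarrow> (\<forall>z w. h (A *v z) w = h z (A *v w))"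

definition pos_def_operator_wrt ::
    "(complex ^ 'n \<Rightarrow> complex ^ 'n \<Rightarrow> complex) \<Rightarrow> complex ^ 'n ^ 'n \<Rightarrow> bool" where
  "pos_def_operator_wrt h A \<longleftrightarrow>
     self_adjoint_wrt h A \<and> (\<forall>z. z \<noteq> 0 \<longrightarrow> 0 < Re (h (A *v z) z))"

text \<open>
  The operations \<open>*\<close> and \<open>^\<close> on the vector type are componentwise, so powers of a matrix are
  iterates of \<open>**\<close>.
\<close>

definition matrix_exp :: "complex ^ 'n ^ 'n \<Rightarrow> complex ^ 'n ^ 'n" where
  "matrix_exp A = (\<Sum>k. (1 / fact k) *\<^sub>R (((\<lambda>B. A ** B) ^^ k) (mat 1)))"

text \<open>
  The logarithm of a positive definite self adjoint operator \<open>A\<close> on the inner product space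
  given by \<open>h\<close> is the self adjoint operator \<open>L\<close> with \<open>exp L = A\<close>; by the spectral theorem there is
  exactly one such \<open>L\<close>.
\<close>

definition is_log_wrt ::
    "(complex ^ 'n \<Rightarrow> complex ^ 'n \<Rightarrow> complex) \<Rightarrow> complex ^ 'n ^ 'n \<Rightarrow> complex ^ 'n ^ 'n \<Rightarrow> bool" where
  "is_log_wrt h A L \<longleftrightarrow> self_adjoint_wrt h L \<and> matrix_exp L = A"

text \<open>
  The curve \<open>E\<close> is \<open>t \<mapsto> A\<^sup>t E\<^sub>h\<close> with \<open>A\<^sup>t = exp (t log A)\<close>; values of \<open>E\<close> outside \<open>[0,1]\<close> are
  irrelevant.
\<close>

definition geodesic_between ::
    "(complex ^ 'n \<Rightarrow> complex ^ 'n \<Rightarrow> complex) \<Rightarrow> (complex ^ 'n \<Rightarrow> complex ^ 'n \<Rightarrow> complex) \<Rightarrow>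
     (real \<Rightarrow> (complex ^ 'n) set) \<Rightarrow> bool" where
  "geodesic_between h k E \<longleftrightarrow>
     (\<exists>A L. pos_def_operator_wrt h A \<and> (\<lambda>z. A *v z) ` ellipsoid_of h = ellipsoid_of k \<and>
        is_log_wrt h A L \<and> (\<forall>t\<in>{0..1}. E t = (\<lambda>z. matrix_exp (t *\<^sub>R L) *v z) ` ellipsoid_of h))"

definition geodesic :: "(real \<Rightarrow> (complex ^ 'n) set) \<Rightarrow> bool" where
  "geodesic E \<longleftrightarrow>
     (\<exists>h k. pos_def_hermitian_form h \<and> pos_def_hermitian_form k \<and> geodesic_between h k E)"

end

theory Submission
  imports Defs "HOL-Complex_Analysis.Cauchy_Integral_Formula"
begin

text \<open>
  Extend the geodesic \<open>A\<^sup>t E\<close> to complex parameters: for imaginary \<open>\<zeta>\<close> the operator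
  \<open>exp (\<zeta> L)\<close> is unitary, so for \<open>v\<close> in a smaller concentric ellipsoid \<open>V\<close> the holomorphic curve
  \<open>\<zeta> \<mapsto> exp (\<zeta> L) v\<close> on the strip \<open>0 \<le> Re \<zeta> \<le> 1\<close> runs inside the compact set of all
  \<open>A\<^sup>x V\<close>, with its boundary in the two end ellipsoids. If this set lies in the domain, the
  maximum principle bounds the exhaustion function on it by its values on the ends. This bound
  survives shrinking all curves by a factor \<open>s \<in> [0,1]\<close>, so the set of admissible \<open>s\<close> is open and
  closed, hence contains \<open>1\<close>.
\<close>

section \<open>Mean values over circles\<close>

lemma holomorphic_mean_value:
  assumes "g holomorphic_on cball a r" "0 < r"
  shows "((\<lambda>\<theta>. g (a + of_real r * cis \<theta>)) has_integral (of_real (2 * pi) * g a)) {0..2 * pi}"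
proof -
  have "((\<lambda>u. g u / (u - a)) has_contour_integral (2 * of_real pi * \<i> * g a)) (circlepath a r)"
    using assms by (intro Cauchy_integral_circlepath_simple) auto
  then have "((\<lambda>\<theta>. g (a + of_real r * cis \<theta>) / (a + of_real r * cis \<theta> - a) * of_real r * \<i> * cis \<theta>)
      has_integral (2 * of_real pi * \<i> * g a)) {0..2 * pi}"
    unfolding circlepath_def by (subst (asm) has_contour_integral_part_circlepath_iff) auto
  then have "((\<lambda>\<theta>. \<i> * g (a + of_real r * cis \<theta>)) has_integral (\<i> * (of_real (2 * pi) * g a))) {0..2 * pi}"
    using assms(2) by (simp add: field_simps)
  from has_integral_mult_right[OF this, of "- \<i>"] show ?thesis
    by (simp flip: mult.assoc)
qed

text \<open>Averaging the bound over the circle removes the term with \<open>g\<close>, whose mean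
  is \<open>Re (g 0) = 0\<close>, so the mean of \<open>f\<close> is at most
  \<open>f a - \<kappa>\<close>, while the sub-mean value property makes it at least
  \<open>f a\<close>. Real parts of holomorphic corrections thus cost nothing.\<close>

lemma cont_subharmonic_not_dominated:
  assumes f: "cont_subharmonic_on D f" and D: "cball a r \<subseteq> D" and r: "0 < r"
    and g: "g holomorphic_on cball 0 r" "g 0 = 0"
    and le: "\<And>\<theta>. f (a + of_real r * cis \<theta>) \<le> f a - \<kappa> + Re (g (of_real r * cis \<theta>))"
  shows "\<kappa> \<le> 0"
proof -
  have cf: "continuous_on D f" and sm: "f a \<le> 1 / (2 * pi) * integral {0..2 * pi} (\<lambda>\<theta>. f (a + of_real r * cis \<theta>))"
    using f D r unfolding cont_subharmonic_on_def by auto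
  have "((\<lambda>\<theta>. g (0 + of_real r * cis \<theta>)) has_integral (of_real (2 * pi) * g 0)) {0..2 * pi}"
    by (rule holomorphic_mean_value[OF g(1) r])
  then have "((\<lambda>\<theta>. Re (g (of_real r * cis \<theta>))) has_integral 0) {0..2 * pi}"
    using has_integral_Re[of _ 0] by (simp add: g(2))
  then have I: "((\<lambda>\<theta>. (f a - \<kappa>) + Re (g (of_real r * cis \<theta>))) has_integral (2 * pi * (f a - \<kappa>) + 0)) {0..2 * pi}"
    using has_integral_const_real[of "f a - \<kappa>" 0 "2 * pi"] by (intro has_integral_add) auto
  have "continuous_on {0..2 * pi} (\<lambda>\<theta>. f (a + of_real r * cis \<theta>))"
    using D r by (intro continuous_on_compose2[OF cf] continuous_intros) 
      (auto simp: norm_mult dist_norm)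
  then have "(\<lambda>\<theta>. f (a + of_real r * cis \<theta>)) integrable_on {0..2 * pi}"
    by (rule integrable_continuous_interval)
  then have "integral {0..2 * pi} (\<lambda>\<theta>. f (a + of_real r * cis \<theta>)) \<le> 2 * pi * (f a - \<kappa>)"
    using has_integral_le[OF integrable_integral I] le by auto
  then have "1 / (2 * pi) * integral {0..2 * pi} (\<lambda>\<theta>. f (a + of_real r * cis \<theta>)) \<le> f a - \<kappa>"
    by (simp add: field_simps)
  with sm show ?thesis by simp
qed

section \<open>The matrix exponential with a complex parameter\<close>

definition matrix_power :: "complex ^ 'n ^ 'n \<Rightarrow> nat \<Rightarrow> complex ^ 'n ^ 'n" where
  "matrix_power L k = ((\<lambda>B. L ** B) ^^ k) (mat 1)"

lemma matrix_power_0 [simp]: "matrix_power L 0 = mat 1"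
  and matrix_power_Suc: "matrix_power L (Suc k) = L ** matrix_power L k"
  by (simp_all add: matrix_power_def)

lemma matrix_power_Suc2: "matrix_power L (Suc k) = matrix_power L k ** L"
proof (induction k)
  case (Suc k)
  then show ?case by (metis matrix_power_Suc matrix_mul_assoc)
qed (simp add: matrix_power_Suc)

text \<open>The sum of all entry norms dominates every row sum of \<open>L\<close>, so each
  multiplication by \<open>L\<close> costs at most this factor. The crude bound majorises the
  exponential series.\<close>

lemma norm_matrix_power_entry_le:
  "norm (matrix_power L k $ i $ j) \<le> (\<Sum>a\<in>UNIV. \<Sum>b\<in>UNIV. norm (L $ a $ b)) ^ k"
proof (induction k arbitrary: i)
  case (Suc k)
  let ?B = "\<Sum>a\<in>UNIV. \<Sum>b\<in>UNIV. norm (L $ a $ b)"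
  have "norm (matrix_power L (Suc k) $ i $ j) \<le> (\<Sum>l\<in>UNIV. norm (L $ i $ l * matrix_power L k $ l $ j))"
    by (simp add: matrix_power_Suc matrix_matrix_mult_def norm_sum)
  also have "\<dots> \<le> (\<Sum>l\<in>UNIV. norm (L $ i $ l) * ?B ^ k)"
    by (intro sum_mono) (simp add: norm_mult mult_left_mono Suc)
  also have "\<dots> \<le> ?B * ?B ^ k"
    unfolding sum_distrib_right[symmetric]
    by (intro mult_right_mono member_le_sum[where f = "\<lambda>a. \<Sum>b\<in>UNIV. norm (L $ a $ b)"])
      (auto intro!: sum_nonneg zero_le_power)
  finally show ?case by simp
qed (simp add: mat_def)

text \<open>An entrywise power series, so that scalar termwise differentiation gives holomorphy in
  \<open>\<zeta>\<close>. It extends the curve of the geodesic to complex time, see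
  \<open>matrix_exp_scaleR\<close>.\<close>

definition matrix_exp_complex :: "complex ^ 'n ^ 'n \<Rightarrow> complex \<Rightarrow> complex ^ 'n ^ 'n" where
  "matrix_exp_complex L \<zeta> = (\<chi> i j. \<Sum>k. matrix_power L k $ i $ j / fact k * \<zeta> ^ k)"

lemma summable_matrix_exp_complex:
  "summable (\<lambda>k. matrix_power L k $ i $ j / fact k * \<zeta> ^ k)"
proof (rule summable_comparison_test')
  let ?B = "\<Sum>a\<in>UNIV. \<Sum>b\<in>UNIV. norm (L $ a $ b)"
  show "summable (\<lambda>k. inverse (fact k) * (?B * norm \<zeta>) ^ k)"
    by (rule summable_exp)
  show "norm (matrix_power L k $ i $ j / fact k * \<zeta> ^ k) \<le> inverse (fact k) * (?B * norm \<zeta>) ^ k" for k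
    using norm_matrix_power_entry_le[of L k i j]
    by (simp add: norm_mult norm_divide norm_power divide_simps power_mult_distrib mult_right_mono)
qed

lemma sums_matrix_exp_complex:
  "(\<lambda>k. matrix_power L k $ i $ j / fact k * \<zeta> ^ k) sums (matrix_exp_complex L \<zeta> $ i $ j)"
  unfolding matrix_exp_complex_def vec_lambda_beta
  by (rule summable_sums[OF summable_matrix_exp_complex])

lemma matrix_exp_complex_0 [simp]: "matrix_exp_complex L 0 = mat 1"
proof -
  have "matrix_exp_complex L 0 $ i $ j = mat 1 $ i $ j" for i j
    using sums_unique2[OF sums_matrix_exp_complex[of L i j 0] powser_sums_zero] by simp
  then show ?thesis by (simp add: vec_eq_iff)
qed

text \<open>\<open>L\<close> commutes with its powers, so the factor \<open>L\<close> can be split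
  off on either side; the addition formula uses both forms.\<close>

lemma has_field_derivative_matrix_exp_complex:
  "((\<lambda>\<zeta>. matrix_exp_complex L \<zeta> $ i $ j) has_field_derivative
     (L ** matrix_exp_complex L \<zeta>) $ i $ j) (at \<zeta>)"
  and has_field_derivative_matrix_exp_complex':
  "((\<lambda>\<zeta>. matrix_exp_complex L \<zeta> $ i $ j) has_field_derivative
     (matrix_exp_complex L \<zeta> ** L) $ i $ j) (at \<zeta>)"
proof -
  let ?c = "\<lambda>k. matrix_power L k $ i $ j / fact k"
  have d: "((\<lambda>\<zeta>. matrix_exp_complex L \<zeta> $ i $ j) has_field_derivative (\<Sum>k. diffs ?c k * \<zeta> ^ k)) (at \<zeta>)"
    unfolding matrix_exp_complex_def vec_lambda_beta
    by (rule termdiffs_strong_converges_everywhere[OF summable_matrix_exp_complex])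
  have c: "diffs ?c k = matrix_power L (Suc k) $ i $ j / fact k" for k
    by (simp add: diffs_def field_simps del: of_nat_Suc)
  have "(\<lambda>k. \<Sum>l\<in>UNIV. L $ i $ l * (matrix_power L k $ l $ j / fact k * \<zeta> ^ k)) sums
      (\<Sum>l\<in>UNIV. L $ i $ l * matrix_exp_complex L \<zeta> $ l $ j)"
    by (intro sums_sum sums_mult sums_matrix_exp_complex)
  then have 1: "(\<lambda>k. diffs ?c k * \<zeta> ^ k) sums (L ** matrix_exp_complex L \<zeta>) $ i $ j"
    by (simp add: c matrix_power_Suc matrix_matrix_mult_def sum_distrib_left sum_divide_distrib mult_ac)
  have "(\<lambda>k. \<Sum>l\<in>UNIV. (matrix_power L k $ i $ l / fact k * \<zeta> ^ k) * L $ l $ j) sums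
      (\<Sum>l\<in>UNIV. matrix_exp_complex L \<zeta> $ i $ l * L $ l $ j)"
    by (intro sums_sum sums_mult2 sums_matrix_exp_complex)
  then have 2: "(\<lambda>k. diffs ?c k * \<zeta> ^ k) sums (matrix_exp_complex L \<zeta> ** L) $ i $ j"
    by (simp add: c matrix_power_Suc2 matrix_matrix_mult_def sum_distrib_left sum_divide_distrib mult_ac)
  show "((\<lambda>\<zeta>. matrix_exp_complex L \<zeta> $ i $ j) has_field_derivative
     (L ** matrix_exp_complex L \<zeta>) $ i $ j) (at \<zeta>)" using d sums_unique[OF 1] by simp
  show "((\<lambda>\<zeta>. matrix_exp_complex L \<zeta> $ i $ j) has_field_derivative
     (matrix_exp_complex L \<zeta> ** L) $ i $ j) (at \<zeta>)" using d sums_unique[OF 2] by simp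
qed

text \<open>The product of the exponentials at \<open>a + b - \<zeta>\<close> and
  \<open>\<zeta>\<close> has derivative zero in \<open>\<zeta>\<close>, so its values at
  \<open>b\<close> and \<open>0\<close> agree.\<close>

lemma matrix_exp_complex_add:
  "matrix_exp_complex L (a + b) = matrix_exp_complex L a ** matrix_exp_complex L b"
proof -
  define F where "F \<zeta> = matrix_exp_complex L (a + b - \<zeta>) ** matrix_exp_complex L \<zeta>" for \<zeta>
  have "((\<lambda>\<zeta>. F \<zeta> $ i $ j) has_field_derivative 0) (at \<zeta>)" for i j \<zeta>
  proof -
    have F: "F \<zeta> $ i $ j =
        (\<Sum>l\<in>UNIV. matrix_exp_complex L (a + b - \<zeta>) $ i $ l * matrix_exp_complex L \<zeta> $ l $ j)" for \<zeta>
      by (simp add: F_def matrix_matrix_mult_def)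
    let ?M = "matrix_exp_complex L (a + b - \<zeta>)" and ?N = "matrix_exp_complex L \<zeta>"
    have "((\<lambda>\<zeta>. F \<zeta> $ i $ j) has_field_derivative
        (\<Sum>l\<in>UNIV. (?M ** L) $ i $ l * (0 - 1) * ?N $ l $ j + (L ** ?N) $ l $ j * ?M $ i $ l)) (at \<zeta>)"
      unfolding F
      by (intro DERIV_sum DERIV_mult has_field_derivative_matrix_exp_complex
        DERIV_chain2[OF has_field_derivative_matrix_exp_complex', where g = "\<lambda>x. a + b - x"]
        DERIV_diff DERIV_const DERIV_ident)
    moreover have "(\<Sum>l\<in>UNIV. (?M ** L) $ i $ l * (0 - 1) * ?N $ l $ j + (L ** ?N) $ l $ j * ?M $ i $ l)
        = (?M ** (L ** ?N)) $ i $ j - ((?M ** L) ** ?N) $ i $ j"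
      by (simp add: matrix_matrix_mult_def[of ?M "L ** ?N"] matrix_matrix_mult_def[of "?M ** L"]
        sum_subtractf sum.distrib sum_negf mult.commute)
    ultimately show ?thesis by (simp add: matrix_mul_assoc)
  qed
  then have "F b $ i $ j = F 0 $ i $ j" for i j
    using has_field_derivative_zero_constant[of UNIV "\<lambda>\<zeta>. F \<zeta> $ i $ j"] by auto
  then have "F b = F 0" by (simp add: vec_eq_iff)
  then show ?thesis by (simp add: F_def)
qed

lemma matrix_exp_scaleR: "matrix_exp (t *\<^sub>R L) = matrix_exp_complex L (of_real t)"
proof -
  have p: "((\<lambda>B. (t *\<^sub>R L) ** B) ^^ k) (mat 1) = t ^ k *\<^sub>R matrix_power L k" for k
    by (induction k) (simp_all add: matrix_power_def flip: scalar_matrix_assoc add: matrix_scalar_ac)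
  have "(\<lambda>k. (1 / fact k) *\<^sub>R (t ^ k *\<^sub>R matrix_power L k)) sums matrix_exp_complex L (of_real t)"
    unfolding sums_def
  proof (intro vec_tendstoI)
    fix i j
    show "(\<lambda>n. (\<Sum>k<n. (1 / fact k) *\<^sub>R (t ^ k *\<^sub>R matrix_power L k)) $ i $ j)
        \<longlonglongrightarrow> matrix_exp_complex L (of_real t) $ i $ j"
      using sums_matrix_exp_complex[of L i j "of_real t"]
      by (simp add: sums_def scaleR_conv_of_real[where 'a = complex] mult_ac)
  qed
  then show ?thesis
    unfolding matrix_exp_def p by (rule sums_unique[symmetric])
qed

section \<open>Maximum principle along holomorphic curves\<close>

lemma norm_vector_scalar_mult: "norm (c *s x) = norm c * norm x" for x :: "complex ^ 'n"
  by (simp add: norm_vec_def norm_mult L2_set_right_distrib)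

text \<open>Supplies the error bound, in the vector norm, for replacing a holomorphic curve by its
  complex tangent line.\<close>

lemma has_derivative_vec_componentwise:
  fixes f :: "complex \<Rightarrow> complex ^ 'n"
  assumes "\<And>i. ((\<lambda>\<zeta>. f \<zeta> $ i) has_field_derivative w $ i) (at a)"
  shows "(f has_derivative (\<lambda>\<eta>. \<eta> *s w)) (at a)"
proof -
  have "((\<lambda>\<zeta>. f \<zeta> $ i \<bullet> b) has_derivative (\<lambda>\<eta>. (\<eta> *s w) $ i \<bullet> b)) (at a)" for i b
    using has_derivative_inner_left[OF assms[of i, unfolded has_field_derivative_def], of b]
    by (simp add: mult.commute)
  then show ?thesis
    by (subst has_derivative_componentwise_within) (auto simp: Basis_vec_def inner_axis)
qed

text \<open>
  Plurisubharmonicity is only given along complex lines. Instead of smoothing \<open>u\<close> to compose it with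
  holomorphic curves, maximise \<open>u z - N |z - F x v|\<^sup>2 + e x\<^sup>2\<close> over \<open>x\<close>, \<open>v\<close> and nearby \<open>z\<close>. At a
  maximum with \<open>0 < x < 1\<close>, move \<open>z\<close> along the complex tangent line of \<open>\<zeta> \<mapsto> F \<zeta> v\<close>: over a
  circle of radius \<open>r\<close> the penalty has mean \<open>N |z - F x v|\<^sup>2 + o(r\<^sup>2)\<close>, whereas the mean of
  \<open>e (Re \<zeta>)\<^sup>2\<close> grows by \<open>e r\<^sup>2 / 2\<close>, contradicting the sub-mean value property.
\<close>

lemma maximum_principle_holomorphic_family:
  fixes \<Omega> :: "(complex ^ 'n) set" and F :: "complex \<Rightarrow> 'v::topological_space \<Rightarrow> complex ^ 'n"
  assumes \<Omega>: "open \<Omega>" and u: "cont_plurisubharmonic_on \<Omega> u" and V: "compact V"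
    and F: "continuous_on ({0..1} \<times> V) (\<lambda>(x, v). F (of_real x) v)"
    and hol: "\<And>v i. v \<in> V \<Longrightarrow> (\<lambda>\<zeta>. F \<zeta> v $ i) holomorphic_on UNIV"
    and inv: "\<And>\<zeta> v. v \<in> V \<Longrightarrow> \<exists>v'\<in>V. F \<zeta> v = F (of_real (Re \<zeta>)) v'"
    and sub: "\<And>x v. x \<in> {0..1} \<Longrightarrow> v \<in> V \<Longrightarrow> F (of_real x) v \<in> \<Omega>"
    and bd0: "\<And>v. v \<in> V \<Longrightarrow> u (F 0 v) \<le> c"
    and bd1: "\<And>v. v \<in> V \<Longrightarrow> u (F 1 v) \<le> c"
    and x0: "x0 \<in> {0..1}" and v0: "v0 \<in> V"
  shows "u (F (of_real x0) v0) \<le> c"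
proof (rule field_le_epsilon)
  fix e' :: real assume "e' > 0"
  \<comment> \<open>One half of \<open>e'\<close> pays for passing from \<open>u y\<close> to
    \<open>u z\<close> at an end, the other for the term \<open>e * x\<^sup>2\<close>.\<close>
  define e where "e = e' / 2"
  then have e: "e > 0" using \<open>e' > 0\<close> by simp
  have cu: "continuous_on \<Omega> u" using u by (simp add: cont_plurisubharmonic_on_def)
  define K where "K = (\<lambda>(x, v). F (of_real x) v) ` ({0..1} \<times> V)"
  have K: "compact K" unfolding K_def
    by (intro compact_continuous_image F compact_Times V compact_Icc)
  have "K \<subseteq> \<Omega>" using sub by (auto simp: K_def)
  then obtain \<delta> where \<delta>: "\<delta> > 0" and Q\<Omega>: "(\<Union>z\<in>K. cball z \<delta>) \<subseteq> \<Omega>"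
    using compact_subset_open_imp_cball_epsilon_subset[OF K \<Omega>] by blast
  define Q where "Q = (\<Union>z\<in>K. cball z \<delta>)"
  have Q: "compact Q" unfolding Q_def by (rule compact_minkowski_sum_cball[OF K])
  have inQ: "z \<in> Q" if "x \<in> {0..1}" "v \<in> V" "norm (z - F (of_real x) v) \<le> \<delta>" for x v z
    using that unfolding Q_def K_def by (force simp: dist_norm norm_minus_commute)
  have cuQ: "continuous_on Q u" using cu Q\<Omega> continuous_on_subset unfolding Q_def by blast
  obtain \<delta>1 where \<delta>1: "\<delta>1 > 0"
    and uc: "\<And>x y. x \<in> Q \<Longrightarrow> y \<in> Q \<Longrightarrow> dist y x < \<delta>1 \<Longrightarrow> dist (u y) (u x) < e"
    using compact_uniformly_continuous[OF cuQ Q] e unfolding uniformly_continuous_on_def by meson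
  obtain m where m: "m > 0" "\<And>z. z \<in> Q \<Longrightarrow> \<bar>u z\<bar> \<le> m"
    using compact_imp_bounded[OF compact_continuous_image[OF cuQ Q]]
    unfolding bounded_pos by auto
  define \<delta>2 where "\<delta>2 = min \<delta> \<delta>1"
  have \<delta>2: "\<delta>2 > 0" "\<delta>2 \<le> \<delta>" "\<delta>2 \<le> \<delta>1" using \<delta> \<delta>1 by (auto simp: \<delta>2_def)
  \<comment> \<open>Makes the penalty at distance \<open>\<delta>2\<close> exceed
    \<open>2 * m\<close>, a bound for the oscillation of \<open>u\<close> on \<open>Q\<close>. A
    maximum then has \<open>norm d < \<delta>2\<close>, which leaves room for a disc around
    \<open>z\<close> and keeps \<open>u z\<close> within \<open>e\<close> of
    \<open>u y\<close>.\<close>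
  define N where "N = 2 * m / \<delta>2\<^sup>2 + 1"
  have N: "N > 0" "2 * m < N * \<delta>2\<^sup>2"
    using m \<delta>2 by (auto simp: N_def field_simps add_pos_pos)
  define G where "G = (\<lambda>(p, z). u z - N * (norm (z - (case p of (x, v) \<Rightarrow> F (of_real x) v)))\<^sup>2 + e * (fst p)\<^sup>2)"
  define D where "D = ({0..1::real} \<times> V) \<times> Q"
  have "continuous_on D G" unfolding G_def D_def case_prod_beta'
    by (intro continuous_intros continuous_on_compose2[OF cuQ]
        continuous_on_compose2[OF F[unfolded case_prod_beta']]) auto
  moreover have "compact D" unfolding D_def by (intro compact_Times V Q compact_Icc)
  moreover have D0: "((x0, v0), F (of_real x0) v0) \<in> D" using x0 v0 inQ \<delta> by (auto simp: D_def)
  ultimately have "\<exists>p\<in>D. \<forall>p'\<in>D. G p' \<le> G p"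
    using continuous_attains_sup[of D G] by blast
  then obtain p where p: "p \<in> D" "\<And>p'. p' \<in> D \<Longrightarrow> G p' \<le> G p" by blast
  obtain x v z where pe: "p = ((x, v), z)" by (metis surj_pair)
  have x: "0 \<le> x" "x \<le> 1" and v: "v \<in> V" and z: "z \<in> Q" using p(1) by (auto simp: D_def pe)
  define y where "y = F (of_real x) v"
  define d where "d = z - y"
  have mx: "u z' - N * (norm (z' - F (of_real x') v'))\<^sup>2 + e * x'\<^sup>2 \<le> u z - N * (norm d)\<^sup>2 + e * x\<^sup>2"
    if "x' \<in> {0..1}" "v' \<in> V" "z' \<in> Q" for x' v' z'
    using p(2)[of "((x', v'), z')"] that by (simp add: G_def D_def pe d_def y_def)
  have yQ: "y \<in> Q" using inQ[of x v y] x v \<delta> by (simp add: y_def)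
  \<comment> \<open>Compare with the competitor \<open>z' = y\<close>, which pays no
    penalty.\<close>
  have "N * (norm d)\<^sup>2 \<le> 2 * m" using mx[of x v y] x v yQ m(2)[OF yQ] m(2)[OF z] by (simp add: y_def)
  then have "N * (norm d)\<^sup>2 < N * \<delta>2\<^sup>2" using N by linarith
  then have d\<delta>: "norm d < \<delta>2"
    using N(1) \<delta>2(1) by (simp add: power2_less_imp_less)
  show "u (F (of_real x0) v0) \<le> c + e'"
  proof (cases "x = 0 \<or> x = 1")
    case True
    then have "u y \<le> c" using bd0 bd1 v by (auto simp: y_def)
    moreover have "\<bar>u z - u y\<bar> < e"
      using uc[OF yQ z] d\<delta> \<delta>2 by (simp add: dist_norm d_def)
    moreover have "u (F (of_real x0) v0) + e * x0\<^sup>2 \<le> u z - N * (norm d)\<^sup>2 + e * x\<^sup>2"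
      using mx[of x0 v0 "F (of_real x0) v0"] x0 v0 D0 by (simp add: D_def)
    moreover have "e * x0\<^sup>2 \<ge> 0" "N * (norm d)\<^sup>2 \<ge> 0" using e N by simp_all
    moreover have "e * x\<^sup>2 \<le> e" using True e by auto
    ultimately show ?thesis unfolding e_def by linarith
  next
    case False
    with x have x: "0 < x" "x < 1" by auto
    define w where "w = (\<chi> i. deriv (\<lambda>\<zeta>. F \<zeta> v $ i) (of_real x))"
    have "((\<lambda>\<zeta>. F \<zeta> v) has_derivative (\<lambda>\<eta>. \<eta> *s w)) (at (of_real x))"
      using hol[OF v] by (intro has_derivative_vec_componentwise)
        (auto simp: w_def intro!: holomorphic_derivI[where S = UNIV])
    \<comment> \<open>A tangent error of at most \<open>e1 * r\<close> costs at most
      \<open>e * r\<^sup>2 / 4\<close> in the penalty, half of the gain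
      \<open>e * r\<^sup>2 / 2\<close>.\<close>
    moreover define e1 where "e1 = sqrt (e / (4 * N))"
    have e1: "e1 > 0" "N * e1\<^sup>2 = e / 4" using e N by (auto simp: e1_def)
    ultimately obtain \<rho> where \<rho>: "\<rho> > 0"
      and small: "\<And>\<zeta>. norm (\<zeta> - of_real x) < \<rho> \<Longrightarrow>
        norm (F \<zeta> v - y - (\<zeta> - of_real x) *s w) \<le> e1 * norm (\<zeta> - of_real x)"
      unfolding has_derivative_at_alt y_def by blast
    \<comment> \<open>The negative of the tangent error: moving \<open>z\<close> by
      \<open>\<eta> *s w\<close> and the curve by \<open>\<eta>\<close> changes the displacement
      from \<open>d\<close> to \<open>d + q \<eta>\<close>.\<close>
    define q where "q \<eta> = \<eta> *s w - (F (of_real x + \<eta>) v - y)" for \<eta>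
    \<comment> \<open>Below \<open>\<rho>\<close> for the tangent estimate, at most \<open>x\<close>
      and \<open>1 - x\<close> to keep real parts in \<open>[0,1]\<close>, and small enough that the
      disc around \<open>z\<close> stays within \<open>\<delta>\<close> of \<open>y\<close>.\<close>
    define r where "r = min (min (\<rho> / 2) x) (min (1 - x) ((\<delta>2 - norm d) / (norm w + 1)))"
    have r: "r > 0" "r < \<rho>" "r \<le> x" "r \<le> 1 - x"
      using \<rho> x d\<delta> by (auto simp: r_def add_nonneg_pos)
    have "0 < norm w + 1" by (simp add: add_nonneg_pos)
    moreover have "r \<le> (\<delta>2 - norm d) / (norm w + 1)" by (simp add: r_def)
    ultimately have "r * (norm w + 1) \<le> \<delta>2 - norm d" by (simp only: pos_le_divide_eq)
    then have rw: "norm d + r * norm w \<le> \<delta>" using r \<delta>2 by (simp add: algebra_simps)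
    have inD: "z + \<eta> *s w \<in> Q" if "norm \<eta> \<le> r" for \<eta>
    proof (rule inQ[of x v])
      have "norm (d + \<eta> *s w) \<le> norm d + r * norm w"
        using norm_triangle_ineq[of d "\<eta> *s w"] mult_right_mono[OF that norm_ge_zero[of w]]
        by (simp add: norm_vector_scalar_mult)
      then show "norm (z + \<eta> *s w - F (of_real x) v) \<le> \<delta>"
        using rw by (simp add: d_def y_def algebra_simps)
    qed (use x v in auto)
    \<comment> \<open>\<open>Re (g \<eta>)\<close> collects the cross term of
      \<open>N * (norm (d + q \<eta>))\<^sup>2\<close> and the harmonic part of
      \<open>- e * (x + Re \<eta>)\<^sup>2\<close>. On the circle \<open>(Re \<eta>)\<^sup>2 =
      r\<^sup>2 / 2 + Re (\<eta>\<^sup>2) / 2\<close>, whose constant is the gain.\<close>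
    define g where "g \<eta> = of_real (2 * N) * (\<Sum>i\<in>UNIV. cnj (d $ i) * q \<eta> $ i)
        - of_real e * (of_real (2 * x) * \<eta> + \<eta>\<^sup>2 / 2)" for \<eta>
    have "(\<lambda>\<eta>. F (of_real x + \<eta>) v $ i) holomorphic_on UNIV" for i
      using holomorphic_on_compose[OF _ holomorphic_on_subset[OF hol[OF v]], of "\<lambda>\<eta>. of_real x + \<eta>" UNIV i]
      by (simp add: o_def holomorphic_intros)
    then have ghol: "g holomorphic_on cball 0 r"
      unfolding g_def q_def vector_minus_component vector_smult_component
      by (intro holomorphic_intros) (auto intro: holomorphic_on_subset)
    have g0: "g 0 = 0" by (simp add: g_def q_def y_def)
    have sh: "cont_subharmonic_on {\<zeta>. z + \<zeta> *s w \<in> \<Omega>} (\<lambda>\<zeta>. u (z + \<zeta> *s w))"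
      using u by (simp add: cont_plurisubharmonic_on_def)
    \<comment> \<open>the holomorphic part \<open>g\<close> of the comparison function averages out over the circle\<close>
    have "e * r\<^sup>2 / 4 \<le> 0"
    proof (rule cont_subharmonic_not_dominated[OF sh _ r(1) ghol g0])
      show "cball 0 r \<subseteq> {\<zeta>. z + \<zeta> *s w \<in> \<Omega>}"
        using inD Q\<Omega> by (auto simp: Q_def)
      fix \<theta>
      define \<eta> where "\<eta> = of_real r * cis \<theta>"
      have n\<eta>: "norm \<eta> = r" using r by (simp add: \<eta>_def norm_mult)
      \<comment> \<open>Trades the complex parameter for its real part, so that the point of the
        curve is a competitor in the maximisation.\<close>
      obtain v' where v': "v' \<in> V" "F (of_real x + \<eta>) v = F (of_real (x + Re \<eta>)) v'"
        using inv[OF v, of "of_real x + \<eta>"] by auto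
      have "x + Re \<eta> \<in> {0..1}" using abs_Re_le_cmod[of \<eta>] r n\<eta> by auto
      from mx[OF this v'(1) inD] n\<eta>
      have 1: "u (z + \<eta> *s w) - N * (norm (z + \<eta> *s w - F (of_real x + \<eta>) v))\<^sup>2 + e * (x + Re \<eta>)\<^sup>2
          \<le> u z - N * (norm d)\<^sup>2 + e * x\<^sup>2"
        by (simp add: v'(2))
      have 2: "z + \<eta> *s w - F (of_real x + \<eta>) v = d + q \<eta>" by (simp add: q_def d_def)
      have 3: "(norm (d + q \<eta>))\<^sup>2 = (norm d)\<^sup>2 + 2 * (d \<bullet> q \<eta>) + (norm (q \<eta>))\<^sup>2"
        by (simp add: power2_norm_eq_inner inner_add_left inner_add_right inner_commute)
      have 4: "d \<bullet> q \<eta> = Re (\<Sum>i\<in>UNIV. cnj (d $ i) * q \<eta> $ i)"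
        by (simp add: inner_vec_def inner_complex_def)
      have "norm (q \<eta>) \<le> e1 * r"
        using small[of "of_real x + \<eta>"] n\<eta> r(2) by (simp add: q_def norm_minus_commute)
      then have "(norm (q \<eta>))\<^sup>2 \<le> (e1 * r)\<^sup>2" by (rule power_mono) simp
      then have "N * (norm (q \<eta>))\<^sup>2 \<le> N * (e1 * r)\<^sup>2" using N by (intro mult_left_mono) auto
      also have "\<dots> = e / 4 * r\<^sup>2" using e1(2) by (simp add: power_mult_distrib flip: mult.assoc)
      finally have 5: "N * (norm (q \<eta>))\<^sup>2 \<le> e * r\<^sup>2 / 4" by simp
      have 6: "(Re \<eta>)\<^sup>2 = r\<^sup>2 / 2 + Re (\<eta>\<^sup>2) / 2"
        using cmod_power2[of \<eta>] n\<eta> by (simp add: power2_eq_square field_simps)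
      have 7: "Re (g \<eta>) = 2 * N * (d \<bullet> q \<eta>) - e * (2 * x * Re \<eta> + Re (\<eta>\<^sup>2) / 2)"
        unfolding g_def 4 by simp
      have "u (z + \<eta> *s w) \<le> u z - e * r\<^sup>2 / 4 + Re (g \<eta>)"
        using 1 5 unfolding 2 3 7 power2_sum 6 by (simp add: algebra_simps)
      then show "u (z + (0 + of_real r * cis \<theta>) *s w) \<le> u (z + 0 *s w) - e * r\<^sup>2 / 4 + Re (g (of_real r * cis \<theta>))"
        by (simp add: \<eta>_def)
    qed
    then show ?thesis using e r by (simp add: mult_le_0_iff)
  qed
qed

section \<open>The exponential acting on vectors\<close>

lemma matrix_exp_complex_holomorphic:
  "(\<lambda>\<zeta>. (matrix_exp_complex L \<zeta> *v v) $ i) holomorphic_on S"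
proof -
  have "(\<lambda>\<zeta>. matrix_exp_complex L \<zeta> $ i $ j) holomorphic_on S" for j
    by (rule holomorphic_on_subset[OF _ subset_UNIV])
      (auto simp: holomorphic_on_open intro: has_field_derivative_matrix_exp_complex)
  then show ?thesis
    unfolding matrix_vector_mult_def vec_lambda_beta by (intro holomorphic_intros)
qed

lemma continuous_on_matrix_exp_complex [continuous_intros]:
  assumes "continuous_on S f" and "continuous_on S g"
  shows "continuous_on S (\<lambda>x. matrix_exp_complex L (f x) *v g x)"
proof -
  have *: "continuous_on UNIV (\<lambda>\<zeta>. matrix_exp_complex L \<zeta> $ i $ j)" for i j
    using DERIV_continuous_on[OF has_field_derivative_at_within[OF has_field_derivative_matrix_exp_complex]]
    by blast
  show ?thesis
    unfolding matrix_vector_mult_def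
    by (intro continuous_intros continuous_on_compose2[OF * assms(1)] assms) auto
qed

lemma sums_matrix_exp_complex_vector:
  "(\<lambda>k. (\<zeta> ^ k / fact k) *s (matrix_power L k *v v)) sums (matrix_exp_complex L \<zeta> *v v)"
  unfolding sums_def
proof (rule vec_tendstoI)
  fix i
  have "(\<lambda>k. \<Sum>j\<in>UNIV. (matrix_power L k $ i $ j / fact k * \<zeta> ^ k) * v $ j) sums
      (\<Sum>j\<in>UNIV. matrix_exp_complex L \<zeta> $ i $ j * v $ j)"
    by (intro sums_sum sums_mult2 sums_matrix_exp_complex)
  then show "(\<lambda>n. (\<Sum>k<n. (\<zeta> ^ k / fact k) *s (matrix_power L k *v v)) $ i)
      \<longlonglongrightarrow> (matrix_exp_complex L \<zeta> *v v) $ i"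
    by (simp add: sums_def matrix_vector_mult_def sum_distrib_left mult_ac)
qed

section \<open>Hermitian forms and the adjoint of the exponential\<close>

context
  fixes h :: "complex ^ 'n \<Rightarrow> complex ^ 'n \<Rightarrow> complex"
  assumes h: "pos_def_hermitian_form h"
begin

lemma form_add_left: "h (z + z') w = h z w + h z' w"
  and form_scale_left: "h (c *s z) w = c * h z w"
  and form_cnj: "h w z = cnj (h z w)"
  and form_pos: "z \<noteq> 0 \<Longrightarrow> 0 < Re (h z z)"
  using h unfolding pos_def_hermitian_form_def by blast+

lemma form_add_right: "h z (w + w') = h z w + h z w'"
  using form_add_left[of w w' z] form_cnj[of z] by simp

lemma form_scale_right: "h z (c *s w) = cnj c * h z w"
  using form_scale_left[of c w z] form_cnj[of z] by simp

text \<open>Over the reals, conjugate linearity is linearity. This gives continuity of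
  \<open>h\<close> and lets it pass through infinite sums.\<close>

lemma bounded_bilinear_form: "bounded_bilinear h"
proof -
  have r: "c *\<^sub>R z = of_real c *s z" for c and z :: "complex ^ 'n"
    by (simp add: vec_eq_iff scaleR_conv_of_real[where 'a = complex])
  have "bilinear h"
    unfolding bilinear_def
    by (auto intro!: linearI simp: form_add_left form_add_right r form_scale_left form_scale_right
        scaleR_conv_of_real[where 'a = complex])
  then show ?thesis by (simp add: bilinear_conv_bounded_bilinear)
qed

lemma form_nonneg: "0 \<le> Re (h z z)"
  using form_pos[of z] bounded_bilinear.zero_left[OF bounded_bilinear_form] by (cases "z = 0") auto

text \<open>Powers of \<open>L\<close> are self-adjoint, and a scalar is conjugated when it moves to
  the second argument; apply this to each term of the series.\<close>

lemma form_matrix_exp_complex: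
  assumes L: "self_adjoint_wrt h L"
  shows "h (matrix_exp_complex L \<zeta> *v v) w = h v (matrix_exp_complex L (cnj \<zeta>) *v w)"
proof -
  have p: "h (matrix_power L k *v v) w = h v (matrix_power L k *v w)" for k v w
  proof (induction k arbitrary: w)
    case (Suc k)
    have "h (matrix_power L (Suc k) *v v) w = h (L *v (matrix_power L k *v v)) w"
      by (simp add: matrix_power_Suc matrix_vector_mul_assoc)
    also have "\<dots> = h (matrix_power L k *v v) (L *v w)"
      using L by (simp add: self_adjoint_wrt_def)
    also have "\<dots> = h v (matrix_power L (Suc k) *v w)"
      by (simp add: Suc matrix_power_Suc2 matrix_vector_mul_assoc)
    finally show ?case .
  qed simp
  have "(\<lambda>k. h ((\<zeta> ^ k / fact k) *s (matrix_power L k *v v)) w) sums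
      h (matrix_exp_complex L \<zeta> *v v) w"
    by (rule bounded_linear.sums[OF bounded_bilinear.bounded_linear_left[OF bounded_bilinear_form]
        sums_matrix_exp_complex_vector])
  moreover have "(\<lambda>k. h v ((cnj \<zeta> ^ k / fact k) *s (matrix_power L k *v w))) sums
      h v (matrix_exp_complex L (cnj \<zeta>) *v w)"
    by (rule bounded_linear.sums[OF bounded_bilinear.bounded_linear_right[OF bounded_bilinear_form]
        sums_matrix_exp_complex_vector])
  ultimately show ?thesis
    by (simp add: form_scale_left form_scale_right p sums_unique2)
qed

text \<open>Here \<open>cnj \<zeta> = - \<zeta>\<close>, so the adjoint is the inverse: the
  exponential is unitary and preserves the sublevel sets of \<open>h v v\<close>.\<close>

lemma form_matrix_exp_complex_imaginary:
  assumes "self_adjoint_wrt h L" and "Re \<zeta> = 0"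
  shows "h (matrix_exp_complex L \<zeta> *v v) (matrix_exp_complex L \<zeta> *v v) = h v v"
proof -
  have "cnj \<zeta> + \<zeta> = 0" using assms(2) by (simp add: complex_eq_iff)
  then show ?thesis
    by (simp add: form_matrix_exp_complex[OF assms(1)] matrix_vector_mul_assoc
        flip: matrix_exp_complex_add)
qed

lemma closed_form_sublevel: "closed {v. Re (h v v) \<le> \<rho>}"
proof -
  have "continuous_on UNIV (\<lambda>v. h v v)"
    by (rule bounded_bilinear.continuous_on[OF bounded_bilinear_form continuous_on_id continuous_on_id])
  then show ?thesis by (intro closed_Collect_le continuous_intros)
qed

end

section \<open>Continuity method in the scaling factor\<close>

theorem theorem1p3:
  fixes \<Omega> :: "(complex ^ 'n) set" and E :: "real \<Rightarrow> (complex ^ 'n) set"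
  assumes "open \<Omega>" and "connected \<Omega>" and "pseudoconvex \<Omega>"
    and "E \<in> {0..1} \<rightarrow> hermitian_ellipsoids" and "geodesic E"
    and "E 0 \<subseteq> \<Omega>" and "E 1 \<subseteq> \<Omega>"
  shows "\<forall>t\<in>{0..1}. E t \<subseteq> \<Omega>"
proof (intro ballI subsetI)
  fix t p assume t: "t \<in> {0..1}" and p: "p \<in> E t"
  obtain h k where h: "pos_def_hermitian_form h" and "geodesic_between h k E"
    using assms(5) unfolding geodesic_def by (elim exE conjE)
  then obtain L where L: "self_adjoint_wrt h L"
    and E: "\<forall>t\<in>{0..1}. E t = (\<lambda>z. matrix_exp (t *\<^sub>R L) *v z) ` ellipsoid_of h"
    unfolding geodesic_between_def is_log_wrt_def by (elim exE conjE)
  define M where "M = matrix_exp_complex L"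
  have E: "E t = (\<lambda>z. M (of_real t) *v z) ` ellipsoid_of h" if "t \<in> {0..1}" for t
    using bspec[OF E that] by (simp add: matrix_exp_scaleR M_def)
  have E0: "E 0 = ellipsoid_of h" and E1: "E 1 = (\<lambda>z. M 1 *v z) ` ellipsoid_of h"
    using E[of 0] E[of 1] by (simp_all add: M_def)
  obtain u where u: "cont_plurisubharmonic_on \<Omega> u" and ex: "\<And>c. compact {z \<in> \<Omega>. u z \<le> c}"
    using assms(3) unfolding pseudoconvex_def by blast
  then have cu: "continuous_on \<Omega> u" by (simp add: cont_plurisubharmonic_on_def)
  obtain v0 where v0: "Re (h v0 v0) < 1" "p = M (of_real t) *v v0"
    using p t by (auto simp: E ellipsoid_of_def)
  \<comment> \<open>The closed concentric ellipsoid through \<open>v0\<close>; its level is below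
    \<open>1\<close>, so it lies in \<open>E 0\<close>.\<close>
  define V where "V = {v. Re (h v v) \<le> Re (h v0 v0)}"
  have VE: "V \<subseteq> E 0" using v0(1) by (auto simp: V_def E0 ellipsoid_of_def)
  have "E 0 \<in> hermitian_ellipsoids" using assms(4) by auto
  then have "bounded (E 0)"
    by (auto simp: hermitian_ellipsoids_def intro!: bounded_linear_image bounded_ball matrix_vector_mul_bounded_linear)
  then have V: "compact V"
    unfolding compact_eq_bounded_closed
    using bounded_subset VE closed_form_sublevel[OF h] by (auto simp: V_def)
  have scale: "of_real s *s v \<in> V" if "v \<in> V" "s \<in> {0..1}" for s v
  proof -
    have "s * s * Re (h v v) \<le> 1 * Re (h v v)"
      using that(2) form_nonneg[OF h] by (intro mult_right_mono mult_le_one) auto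
    then show ?thesis
      using that(1) by (simp add: V_def form_scale_left[OF h] form_scale_right[OF h] mult.assoc)
  qed
  define C where "C = {0..1::real} \<times> V"
  have C: "compact C" unfolding C_def by (intro compact_Times V compact_Icc)
  define f where "f s x v = M (of_real x) *v (of_real s *s v)" for s x :: real and v
  have ends: "V \<union> (\<lambda>v. M 1 *v v) ` V \<subseteq> \<Omega>"
    using VE assms(6,7) by (auto simp: E0 E1)
  have "compact (V \<union> (\<lambda>v. M 1 *v v) ` V)"
    unfolding M_def by (intro compact_Un V compact_continuous_image continuous_intros)
  then have "bounded (u ` (V \<union> (\<lambda>v. M 1 *v v) ` V))"
    by (intro compact_imp_bounded compact_continuous_image continuous_on_subset[OF cu ends])
  \<comment> \<open>Since \<open>V\<close> is stable under the factors \<open>s\<close> by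
    \<open>scale\<close>, this one \<open>c\<close> bounds \<open>u\<close> at the ends of all
    shrunken curves.\<close>
  then obtain c where c: "\<And>z. z \<in> V \<union> (\<lambda>v. M 1 *v v) ` V \<Longrightarrow> u z \<le> c"
    unfolding bounded_real by (meson abs_le_D1 imageI)
  \<comment> \<open>The exhaustion property enters here: a compact sublevel set is closed in the
    whole space, not merely relative to \<open>\<Omega>\<close>.\<close>
  define P where "P = {z \<in> \<Omega>. u z \<le> c}"
  have P: "closed P" unfolding P_def by (intro compact_imp_closed ex)
  have max: "f s x v \<in> P"
    if s: "s \<in> {0..1}" and in\<Omega>: "\<forall>x v. (x, v) \<in> C \<longrightarrow> f s x v \<in> \<Omega>"
      and xv: "(x, v) \<in> C" for s x v
  proof -
    have xv: "x \<in> {0..1}" "v \<in> V" using xv by (auto simp: C_def)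
    have "u (M (of_real x) *v (of_real s *s v)) \<le> c"
    proof (rule maximum_principle_holomorphic_family[OF assms(1) u V,
          where F = "\<lambda>\<zeta> v. M \<zeta> *v (of_real s *s v)"])
      show "continuous_on ({0..1} \<times> V) (\<lambda>(x, v). M (of_real x) *v (of_real s *s v))"
        unfolding M_def case_prod_beta' vector_scalar_mult_def by (intro continuous_intros)
      show "(\<lambda>\<zeta>. (M \<zeta> *v (of_real s *s v)) $ i) holomorphic_on UNIV" for v i
        unfolding M_def by (rule matrix_exp_complex_holomorphic)
      show "\<exists>v'\<in>V. M \<zeta> *v (of_real s *s v) = M (of_real (Re \<zeta>)) *v (of_real s *s v')"
        if "v \<in> V" for \<zeta> v
      proof
        \<comment> \<open>Split off the imaginary part of \<open>\<zeta>\<close>: its factor is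
          unitary and maps \<open>V\<close> to itself.\<close>
        have "M \<zeta> = M (of_real (Re \<zeta>)) ** M (\<i> * of_real (Im \<zeta>))"
          unfolding M_def matrix_exp_complex_add[symmetric] by (simp flip: complex_eq)
        then show "M \<zeta> *v (of_real s *s v) =
            M (of_real (Re \<zeta>)) *v (of_real s *s (M (\<i> * of_real (Im \<zeta>)) *v v))"
          by (simp add: matrix_vector_mul_assoc flip: vector_scalar_commute)
        show "M (\<i> * of_real (Im \<zeta>)) *v v \<in> V"
          using that by (simp add: V_def M_def form_matrix_exp_complex_imaginary[OF h L])
      qed
      show "M (of_real x) *v (of_real s *s v) \<in> \<Omega>" if "x \<in> {0..1}" "v \<in> V" for x v
        using in\<Omega> that by (auto simp: C_def f_def)
      show "u (M 0 *v (of_real s *s v)) \<le> c" if "v \<in> V" for v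
        using c scale[OF that s] by (simp add: M_def)
      show "u (M 1 *v (of_real s *s v)) \<le> c" if "v \<in> V" for v
        using c scale[OF that s] by simp
    qed (use xv in auto)
    then show ?thesis using in\<Omega> xv by (auto simp: P_def f_def C_def)
  qed
  \<comment> \<open>By \<open>max\<close>, a scaling factor whose curves stay in
    \<open>\<Omega>\<close> already has them in \<open>P\<close>. So \<open>S1\<close> and
    \<open>S2\<close> are disjoint closed sets covering \<open>[0,1]\<close>, and connectedness
    leaves only one of them nonempty.\<close>
  define S1 where "S1 = {s \<in> {0..1}. \<forall>x v. (x, v) \<in> C \<longrightarrow> f s x v \<in> P}"
  define S2 where "S2 = {s \<in> {0..1}. \<exists>x v. (x, v) \<in> C \<and> f s x v \<notin> \<Omega>}"
  have "closed ((\<lambda>s. f s x v) -` P)" for x v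
    unfolding f_def M_def vector_scalar_mult_def
    by (intro closed_vimage P continuous_intros)
  moreover have "S1 = {0..1} \<inter> (\<Inter>(x, v)\<in>C. (\<lambda>s. f s x v) -` P)"
    by (auto simp: S1_def)
  ultimately have "closed S1" by (auto intro!: closed_Int closed_INT)
  \<comment> \<open>Leaving \<open>\<Omega>\<close> is a closed condition on
    \<open>(s, x, v)\<close>; as \<open>C\<close> is compact, its projection to \<open>s\<close> is
    closed too.\<close>
  have "closed ((\<lambda>(s, x, v). f s x v) -` (- \<Omega>))"
    unfolding f_def M_def vector_scalar_mult_def case_prod_beta'
    by (intro closed_vimage closed_Compl assms(1) continuous_intros)
  then have "compact (fst ` (({0..1} \<times> C) \<inter> (\<lambda>(s, x, v). f s x v) -` (- \<Omega>)))"
    by (rule compact_continuous_image[OF continuous_on_fst[OF continuous_on_id]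
          compact_Int_closed[OF compact_Times[OF compact_Icc C]]])
  moreover have "S2 = fst ` (({0..1} \<times> C) \<inter> (\<lambda>(s, x, v). f s x v) -` (- \<Omega>))"
    by (force simp: S2_def image_iff)
  ultimately have "closed S2" by (simp add: compact_imp_closed)
  have cover: "{0..1} \<subseteq> S1 \<union> S2" using max unfolding S1_def S2_def by blast
  have disj: "S1 \<inter> S2 \<inter> {0..1} = {}" by (auto simp: S1_def S2_def P_def)
  \<comment> \<open>For \<open>s = 0\<close> every curve collapses to the origin, which lies in
    \<open>V\<close>.\<close>
  have "0 \<in> S1"
  proof -
    have "v0 \<in> V" by (simp add: V_def)
    then have "f 0 x v \<in> V" for x v
      using scale[of v0 0] by (simp add: f_def)
    then have "\<forall>x v. (x, v) \<in> C \<longrightarrow> f 0 x v \<in> \<Omega>" using ends by auto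
    then show ?thesis using max[of 0] by (auto simp: S1_def)
  qed
  then have "1 \<notin> S2"
    using connected_closedD[OF connected_Icc disj cover \<open>closed S1\<close> \<open>closed S2\<close>] by auto
  then have "\<forall>x v. (x, v) \<in> C \<longrightarrow> f 1 x v \<in> \<Omega>" by (auto simp: S2_def)
  moreover have "(t, v0) \<in> C" using t by (simp add: C_def V_def)
  ultimately show "p \<in> \<Omega>" by (auto simp: f_def v0(2))
qed

end
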